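(* Let $m=(m_0,m_1,\dots)$ be a sequence of integers $m_k\ge 2$ with $\sup_{k}m_k<\infty$, let $G_m$ be the corresponding bounded Vilenkin group, and let $H_1(G_m)$ be the martingale Hardy space on $G_m$. Then there exists $f\in H_1(G_m)$ such that $$\sup_{n\in\mathbb{N}_+}\frac{1}{n}\sum_{k=1}^{n}\left\|S_kf\right\|_1=\infty,$$ where $S_kf$ denotes the $k$-th partial sum of the Vilenkin-Fourier series of $f$ and $\|\cdot\|_1$ is the norm of $L_1(G_m)$.
   Context: Let $\mathbb{N}_+$ be the set of positive integers and $\mathbb{N}=\mathbb{N}_+\cup\{0\}$. Let $m=(m_0,m_1,\dots)$ be a sequence of integers with $m_k\ge 2$, and let $Z_{m_k}=\{0,1,\dots,m_k-1\}$ be the additive group of integers modulo $m_k$. The Vilenkin group $G_m=\prod_{k=0}^\infty Z_{m_k}$ is the complete direct product with the product of the discrete topologies. Its elements are sequences $x=(x_0,x_1,\dots)$ with $x_k\in Z_{m_k}$. The group is called bounded if $\sup_k m_k<\infty$. Let $\mu$ be the product of the measures $\mu_k(\{j\})=1/m_k$ $(j\in Z_{m_k})$; this is the normalized Haar measure on $G_m$, with $\mu(G_m)=1$. Write $\|f\|_1=\int_{G_m}|f|\,d\mu$ for the norm of $L_1(G_m)$ (complex-valued functions). For $x\in G_m$ put $I_0(x)=G_m$ and $I_n(x)=\{y\in G_m: y_0=x_0,\dots,y_{n-1}=x_{n-1}\}$ for $n\ge 1$. Put $M_0=1$ and $M_{k+1}=m_kM_k$. Every $n\in\mathbb{N}$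 has a unique expansion $n=\sum_{j=0}^\infty n_jM_j$ with $n_j\in Z_{m_j}$ and only finitely many $n_j\neq 0$. The generalized Rademacher functions are $r_k(x)=\exp(2\pi i x_k/m_k)$. The Vilenkin system is $(\psi_n)_{n\in\mathbb{N}}$ with $\psi_n(x)=\prod_{k=0}^\infty r_k(x)^{n_k}$. For $f\in L_1(G_m)$, the Fourier coefficients are $\widehat f(k)=\int_{G_m}f\,\overline{\psi_k}\,d\mu$ $(k\in\mathbb{N})$, and the partial sums are $S_0f=0$ and $S_nf=\sum_{k=0}^{n-1}\widehat f(k)\psi_k$ $(n\in\mathbb{N}_+)$. The maximal function of $f\in L_1(G_m)$ is $$f^*(x)=\sup_{n\in\mathbb{N}}\frac{1}{\mu(I_n(x))}\left|\int_{I_n(x)}f\,d\mu\right|.$$ The martingale Hardy space $H_1(G_m)$ consists of all martingales $f$ (with respect to the filtration of $\sigma$-algebras generated by the sets $\{I_n(x):x\in G_m\}$, $n\in\mathbb{N}$) with $\|f\|_{H_1}:=\|f^*\|_1<\infty$. Each such martingale is generated by a function in $L_1(G_m)$, with which it is identified. Thus $H_1(G_m)=\{f\in L_1(G_m): f^*\in L_1(G_m)\}$, and for $f\in H_1(G_m)$ the partial sums are $S_0f=0$ and $S_kf=\sum_{j=0}^{k-1}\widehat f(j)\psi_j$ $(k\in\mathbb{N}_+)$, where $\widehat f(j)=\int_{G_m}f\,\overline{\psi_j}\,d\mu$. *)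

theory Defs
  imports "HOL-Probability.Probability"
begin

text \<open>
  The sequence \<open>m\<close> is a parameter of all notions below; it is only meant to be
  used with \<open>m k \<ge> 2\<close> for all \<open>k\<close>. The group \<open>Z\<close> modulo \<open>m k\<close> is represented by
  \<open>{..<m k}\<close>, so points of the Vilenkin group are functions \<open>x\<close> with \<open>x k < m k\<close>.
\<close>

definition vilenkin :: "(nat \<Rightarrow> nat) \<Rightarrow> (nat \<Rightarrow> nat) measure" where
  "vilenkin m = (\<Pi>\<^sub>M k\<in>UNIV. uniform_count_measure {..<m k})"

definition cylinder :: "(nat \<Rightarrow> nat) \<Rightarrow> nat \<Rightarrow> (nat \<Rightarrow> nat) \<Rightarrow> (nat \<Rightarrow> nat) set" where
  "cylinder m n x = {y \<in> space (vilenkin m). \<forall>k<n. y k = x k}"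

primrec gen_pow :: "(nat \<Rightarrow> nat) \<Rightarrow> nat \<Rightarrow> nat" where
  "gen_pow m 0 = 1"
| "gen_pow m (Suc k) = m k * gen_pow m k"

definition digit :: "(nat \<Rightarrow> nat) \<Rightarrow> nat \<Rightarrow> nat \<Rightarrow> nat" where
  "digit m n j = (n div gen_pow m j) mod m j"

definition rademacher :: "(nat \<Rightarrow> nat) \<Rightarrow> nat \<Rightarrow> (nat \<Rightarrow> nat) \<Rightarrow> complex" where
  "rademacher m k x = exp (2 * of_real pi * \<i> * of_nat (x k) / of_nat (m k))"

text \<open>Factors with digit \<open>0\<close> equal \<open>1\<close>; only finitely many others occur, see
  \<open>finite_digits\<close> below.\<close>

definition psi :: "(nat \<Rightarrow> nat) \<Rightarrow> nat \<Rightarrow> (nat \<Rightarrow> nat) \<Rightarrow> complex" where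
  "psi m n x = (\<Prod>k | digit m n k \<noteq> 0. rademacher m k x ^ digit m n k)"

definition fourier_coeff :: "(nat \<Rightarrow> nat) \<Rightarrow> ((nat \<Rightarrow> nat) \<Rightarrow> complex) \<Rightarrow> nat \<Rightarrow> complex" where
  "fourier_coeff m f k = (\<integral>x. f x * cnj (psi m k x) \<partial>vilenkin m)"

definition partial_sum ::
  "(nat \<Rightarrow> nat) \<Rightarrow> ((nat \<Rightarrow> nat) \<Rightarrow> complex) \<Rightarrow> nat \<Rightarrow> (nat \<Rightarrow> nat) \<Rightarrow> complex" where
  "partial_sum m f n x = (\<Sum>k<n. fourier_coeff m f k * psi m k x)"

definition L1_norm :: "(nat \<Rightarrow> nat) \<Rightarrow> ((nat \<Rightarrow> nat) \<Rightarrow> complex) \<Rightarrow> real" where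
  "L1_norm m f = (\<integral>x. cmod (f x) \<partial>vilenkin m)"

text \<open>The maximal function may take the value \<open>\<infinity>\<close>.\<close>

definition maximal_fun ::
  "(nat \<Rightarrow> nat) \<Rightarrow> ((nat \<Rightarrow> nat) \<Rightarrow> complex) \<Rightarrow> (nat \<Rightarrow> nat) \<Rightarrow> ennreal" where
  "maximal_fun m f x =
     (SUP n. ennreal (1 / measure (vilenkin m) (cylinder m n x) *
                      cmod (\<integral>y\<in>cylinder m n x. f y \<partial>vilenkin m)))"

definition H1_norm :: "(nat \<Rightarrow> nat) \<Rightarrow> ((nat \<Rightarrow> nat) \<Rightarrow> complex) \<Rightarrow> ennreal" where
  "H1_norm m f = (\<integral>\<^sup>+x. maximal_fun m f x \<partial>vilenkin m)"

text \<open>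
  Martingales with integrable maximal function are identified with the integrable
  functions generating them.
\<close>

definition H1 :: "(nat \<Rightarrow> nat) \<Rightarrow> ((nat \<Rightarrow> nat) \<Rightarrow> complex) set" where
  "H1 m = {f. integrable (vilenkin m) f \<and> H1_norm m f < \<infinity>}"


lemma space_vilenkin: "space (vilenkin m) = {x. \<forall>k. x k < m k}"
  by (auto simp: vilenkin_def space_PiM PiE_def space_uniform_count_measure)

lemma prob_space_vilenkin:
  assumes "\<And>k. m k \<ge> 2"
  shows "prob_space (vilenkin m)"
  unfolding vilenkin_def
proof (rule prob_space_PiM)
  fix k
  have "{..<m k} \<noteq> {}" using assms[of k] by (auto simp: lessThan_empty_iff)
  then show "prob_space (uniform_count_measure {..<m k})"
    by (intro prob_space_uniform_count_measure) auto
qed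

lemma gen_pow_gt:
  assumes "\<And>k. m k \<ge> 2"
  shows "n < gen_pow m n"
proof (induction n)
  case (Suc n)
  have "Suc n < 2 * gen_pow m n" using Suc by linarith
  also have "2 * gen_pow m n \<le> m n * gen_pow m n" using assms[of n] by simp
  finally show ?case by simp
qed simp

lemma digit_eq_0:
  assumes "\<And>k. m k \<ge> 2" and "n \<le> j"
  shows "digit m n j = 0"
  using gen_pow_gt[of m j] assms by (simp add: digit_def)

lemma finite_digits:
  assumes "\<And>k. m k \<ge> 2"
  shows "finite {j. digit m n j \<noteq> 0}"
  by (rule finite_subset[of _ "{..<n}"]) (use digit_eq_0[of m n] assms in \<open>force simp: not_less[symmetric]\<close>)+

lemma digit_less:
  assumes "\<And>k. m k \<ge> 2"
  shows "digit m n j < m j"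
  using assms[of j] by (simp add: digit_def)

lemma digit_sum_mod: "(\<Sum>j<k. digit m n j * gen_pow m j) = n mod gen_pow m k"
proof (induction k)
  case (Suc k)
  have "n mod (gen_pow m k * m k) = gen_pow m k * (n div gen_pow m k mod m k) + n mod gen_pow m k"
    by (rule mod_mult2_eq)
  with Suc show ?case by (simp add: digit_def mult.commute)
qed simp

lemma digit_expansion:
  assumes "\<And>k. m k \<ge> 2"
  shows "(\<Sum>j | digit m n j \<noteq> 0. digit m n j * gen_pow m j) = n"
proof -
  have sub: "{j. digit m n j \<noteq> 0} \<subseteq> {..<n}"
  proof
    fix j assume "j \<in> {j. digit m n j \<noteq> 0}"
    with digit_eq_0[OF assms, of n j] show "j \<in> {..<n}" by (cases "n \<le> j") auto
  qed
  have "(\<Sum>j | digit m n j \<noteq> 0. digit m n j * gen_pow m j) = (\<Sum>j<n. digit m n j * gen_pow m j)"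
    by (rule sum.mono_neutral_left[OF finite_lessThan sub]) auto
  also have "\<dots> = n mod gen_pow m n"
    by (rule digit_sum_mod)
  also have "\<dots> = n"
    by (intro mod_less gen_pow_gt assms)
  finally show ?thesis .
qed

lemma measurable_coordinate: "(\<lambda>x. x k) \<in> vilenkin m \<rightarrow>\<^sub>M count_space UNIV"
proof -
  have "(\<lambda>x. x k) \<in> vilenkin m \<rightarrow>\<^sub>M uniform_count_measure {..<m k}"
    unfolding vilenkin_def by (rule measurable_component_singleton) simp
  also have "\<dots> = vilenkin m \<rightarrow>\<^sub>M count_space {..<m k}"
    by (intro measurable_cong_sets) (simp_all add: sets_uniform_count_measure)
  finally have *: "(\<lambda>x. x k) \<in> vilenkin m \<rightarrow>\<^sub>M count_space {..<m k}" .
  have "(\<lambda>i. i) \<in> count_space {..<m k} \<rightarrow>\<^sub>M count_space (UNIV :: nat set)"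
    by simp
  from measurable_compose[OF * this] show ?thesis .
qed

lemma measurable_prefix:
  "(\<lambda>x. map x [0..<n]) \<in> vilenkin m \<rightarrow>\<^sub>M count_space UNIV"
proof -
  have "(\<lambda>x. map x [0..<n]) -` {l} \<inter> space (vilenkin m) \<in> sets (vilenkin m)" for l
  proof (cases "length l = n")
    case True
    have "map x [0..<n] = l \<longleftrightarrow> (\<forall>k\<in>{..<n}. x k = l ! k)" for x
      unfolding list_eq_iff_nth_eq using True by (simp add: Ball_def)
    then have "(\<lambda>x. map x [0..<n]) -` {l} \<inter> space (vilenkin m)
        = {x \<in> space (vilenkin m). \<forall>k\<in>{..<n}. x k = l ! k}"
      by blast
    also have "\<dots> \<in> sets (vilenkin m)"
    proof (rule sets.sets_Collect_finite_All)
      fix k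
      have "(\<lambda>x. x k) -` {l ! k} \<inter> space (vilenkin m) \<in> sets (vilenkin m)"
        by (rule measurable_sets[OF measurable_coordinate]) simp
      also have "(\<lambda>x. x k) -` {l ! k} \<inter> space (vilenkin m)
          = {x \<in> space (vilenkin m). x k = l ! k}" by auto
      finally show "{x \<in> space (vilenkin m). x k = l ! k} \<in> sets (vilenkin m)" .
    qed simp
    finally show ?thesis .
  next
    case False
    then have "(\<lambda>x. map x [0..<n]) -` {l} \<inter> space (vilenkin m) = {}" by auto
    then show ?thesis by simp
  qed
  then show ?thesis by (subst measurable_count_space_eq_countable) auto
qed

lemma measurable_maximal_fun: "maximal_fun m f \<in> borel_measurable (vilenkin m)"
proof -
  define t where "t n C = ennreal (1 / measure (vilenkin m) C *
      cmod (\<integral>y\<in>C. f y \<partial>vilenkin m))" for n :: nat and C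
  have "(\<lambda>x. t n (cylinder m n x)) \<in> borel_measurable (vilenkin m)" for n
  proof -
    have "(\<lambda>x. t n (cylinder m n x))
        = (\<lambda>x. (\<lambda>l. t n {y \<in> space (vilenkin m). map y [0..<n] = l}) (map x [0..<n]))"
      by (simp add: cylinder_def Ball_def)
    then show ?thesis
      by (simp only:) (rule measurable_compose[OF measurable_prefix], simp)
  qed
  then have "(\<lambda>x. SUP n. t n (cylinder m n x)) \<in> borel_measurable (vilenkin m)"
    by measurable
  then show ?thesis
    by (simp add: t_def maximal_fun_def[abs_def])
qed

end

theory Submission
  imports Defs
begin

text \<open>
  Write \<open>M n\<close> for \<open>gen_pow m n\<close>, \<open>D n\<close> for the Dirichlet kernel \<open>\<Sum>i<n. psi m i\<close>, and \<open>I n\<close> for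
  the subgroup of points whose first \<open>n\<close> coordinates vanish, which has measure \<open>1 / M n\<close>. The function
  is a series \<open>f = (\<Sum>n. c n * d n)\<close> of the blocks \<open>d n = D (M (n + 1)) - D (M n)\<close> with nonnegative
  summable weights \<open>c\<close>, chosen so sparse that \<open>c N * N\<close> is nevertheless unbounded
  (\<open>exists_summable_weight\<close>).

  Membership in \<open>H\<^sub>1\<close> is easy because blocks are martingale differences. As \<open>D (M n)\<close> equals \<open>M n\<close> on \<open>I n\<close>
  and \<open>0\<close> elsewhere, the average of \<open>d n\<close> over the cylinder of order \<open>k\<close> around \<open>x\<close> is \<open>d n x\<close> if
  \<open>n < k\<close> and \<open>0\<close> otherwise (\<open>norm_integral_block_cylinder_le\<close>). So the maximal function of \<open>f\<close> is at most
  \<open>\<Sum>n. c n * \<bar>d n\<bar>\<close>, and this is integrable since each block has \<open>L\<^sub>1\<close> norm at most \<open>2\<close>.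

  For the divergence, let \<open>M N \<le> k \<le> M (N + 1)\<close>. Orthonormality of the system shows that the
  \<open>k\<close>-th partial sum of \<open>f\<close> is \<open>(\<Sum>n<N. c n * d n) + c N * (D k - D (M N))\<close>; the first part is bounded in
  \<open>L\<^sub>1\<close>. Outside \<open>I N\<close> the kernel \<open>D (M N)\<close> vanishes, and on a shell \<open>I s - I (s + 1)\<close>
  with \<open>s < N\<close> the kernel \<open>D k\<close> sees only the lower digits of \<open>k\<close>: if the \<open>s\<close>-th digit is \<open>0\<close>, then
  \<open>\<bar>D k\<bar> = k mod M (s + 1)\<close>, a number below \<open>M s\<close> (\<open>norm_dirichlet_shell\<close>). When the \<open>m k\<close> are bounded by \<open>B\<close>, a
  fraction at least \<open>1 / B\<close> of all \<open>k\<close> has this digit \<open>0\<close>, and for them \<open>k mod M (s + 1)\<close> is of the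
  order of \<open>M s\<close> on average (\<open>sum_shell_value\<close>). The shell has measure at least \<open>1 / (2 * M s)\<close>, so each
  of the \<open>N - 1\<close> shells with \<open>1 \<le> s < N\<close> contributes at least a constant, depending only on \<open>B\<close>, to the mean of
  \<open>\<parallel>D k\<parallel>\<^sub>1\<close> over the range of \<open>k\<close>. Hence the mean of the norms of the first \<open>M (N + 1)\<close> partial sums
  is at least \<open>c N * (N - 1) / (16 * B)\<close> minus a constant (\<open>average_L1_norm_ge\<close>).
\<close>

section \<open>Vilenkin functions and their orthonormality\<close>

locale vilenkin_group =
  fixes m :: "nat \<Rightarrow> nat"
  assumes ge2: "\<And>k. m k \<ge> 2"

sublocale vilenkin_group \<subseteq> prob_space "vilenkin m"
  using ge2 by (rule prob_space_vilenkin)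

context vilenkin_group
begin

lemma gen_pow_pos: "gen_pow m n > 0"
  using gen_pow_gt[of m n, OF ge2] by simp

lemma gen_pow_dvd:
  assumes "i \<le> j"
  shows "gen_pow m i dvd gen_pow m j"
  using assms by (induction rule: dec_induct) auto

lemma gen_pow_mono: "i \<le> j \<Longrightarrow> gen_pow m i \<le> gen_pow m j"
  using gen_pow_dvd gen_pow_pos by (simp add: dvd_imp_le)

lemma digit_eq_0_beyond:
  assumes "n < gen_pow m N" "N \<le> j"
  shows "digit m n j = 0"
  using assms gen_pow_mono[of N j] by (simp add: digit_def)

lemma digits_inject:
  assumes "\<And>j. digit m a j = digit m b j"
  shows "a = b"
  using digit_expansion[of m a, OF ge2] digit_expansion[of m b, OF ge2] assms by simp

text \<open>
  Adding \<open>b < M n\<close> to a multiple of \<open>M n\<close> produces no carry: the two summands occupy disjoint digit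
  positions. Multiplicativity of the Vilenkin functions across such sums is what makes the Dirichlet
  kernels computable.
\<close>

lemma digit_add:
  assumes "b < gen_pow m n"
  shows "digit m (a * gen_pow m n + b) j = digit m (a * gen_pow m n) j + digit m b j"
proof (cases "j < n")
  case True
  then have "gen_pow m (Suc j) dvd gen_pow m n"
    by (intro gen_pow_dvd) simp
  then obtain c where c: "gen_pow m n = gen_pow m j * (m j * c)"
    by (auto simp: dvd_def ac_simps)
  have eq: "a * gen_pow m n + b = b + gen_pow m j * (m j * (a * c))"
    by (simp add: c ac_simps)
  have 1: "digit m (a * gen_pow m n + b) j = digit m b j"
    unfolding digit_def eq using gen_pow_pos[of j] by simp
  have eq0: "a * gen_pow m n = gen_pow m j * (m j * (a * c))"
    by (simp add: c ac_simps)
  have "digit m (a * gen_pow m n) j = 0"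
    unfolding digit_def eq0 using gen_pow_pos[of j] by simp
  with 1 show ?thesis by simp
next
  case False
  then have "gen_pow m n dvd gen_pow m j"
    by (intro gen_pow_dvd) simp
  then obtain c where c: "gen_pow m j = gen_pow m n * c" by auto
  have "(a * gen_pow m n + b) div gen_pow m j = a * gen_pow m n div gen_pow m j"
    using assms gen_pow_pos[of n] by (simp add: c div_mult2_eq)
  moreover have "digit m b j = 0"
    using False assms by (intro digit_eq_0_beyond[of b n]) auto
  ultimately show ?thesis by (simp add: digit_def)
qed

lemma digit_mult_gen_pow:
  assumes "a < m s"
  shows "digit m (a * gen_pow m s) j = (if j = s then a else 0)"
proof -
  consider "j < s" | "j = s" | "Suc s \<le> j" by linarith
  then show ?thesis
  proof cases
    case 1
    then have "gen_pow m (Suc j) dvd gen_pow m s"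
      by (intro gen_pow_dvd) simp
    then obtain c where c: "gen_pow m s = gen_pow m j * (m j * c)"
      by (auto simp: dvd_def ac_simps)
    have eq: "a * gen_pow m s = gen_pow m j * (m j * (a * c))"
      by (simp add: c ac_simps)
    show ?thesis
      unfolding digit_def eq using gen_pow_pos[of j] 1 by simp
  next
    case 2
    then show ?thesis using assms gen_pow_pos[of s] by (simp add: digit_def)
  next
    case 3
    have "a * gen_pow m s < gen_pow m (Suc s)"
      using assms gen_pow_pos[of s] by simp
    with digit_eq_0_beyond[OF this 3] 3 show ?thesis by simp
  qed
qed

lemma psi_eq_prod:
  assumes "n < gen_pow m N"
  shows "psi m n x = (\<Prod>j<N. rademacher m j x ^ digit m n j)"
  unfolding psi_def
proof (rule prod.mono_neutral_left)
  show "{k. digit m n k \<noteq> 0} \<subseteq> {..<N}"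
    using digit_eq_0_beyond[OF assms] by (force simp: not_less[symmetric])
qed auto

lemma psi_add:
  assumes "b < gen_pow m n"
  shows "psi m (a * gen_pow m n + b) x = psi m (a * gen_pow m n) x * psi m b x"
proof -
  define N where "N = a * gen_pow m n + b"
  have N: "a * gen_pow m n + b < gen_pow m N"
    using gen_pow_gt[of m N, OF ge2] by (simp add: N_def)
  then have "a * gen_pow m n < gen_pow m N" "b < gen_pow m N" by auto
  from psi_eq_prod[OF N] psi_eq_prod[OF this(1)] psi_eq_prod[OF this(2)] show ?thesis
    by (simp add: digit_add[OF assms] power_add prod.distrib)
qed

lemma psi_mult_gen_pow:
  assumes "a < m s"
  shows "psi m (a * gen_pow m s) x = rademacher m s x ^ a"
proof (cases "a = 0")
  case True
  then show ?thesis by (simp add: psi_def digit_def)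
next
  case False
  then have "{k. digit m (a * gen_pow m s) k \<noteq> 0} = {s}"
    by (auto simp: digit_mult_gen_pow[OF assms])
  then show ?thesis by (simp add: psi_def digit_mult_gen_pow[OF assms])
qed

lemma norm_rademacher [simp]: "cmod (rademacher m k x) = 1"
  by (simp add: rademacher_def norm_exp_eq_Re)

lemma norm_psi [simp]: "cmod (psi m n x) = 1"
  by (simp add: psi_def norm_power prod_norm[symmetric])

lemma measurable_psi [measurable]: "psi m n \<in> borel_measurable (vilenkin m)"
proof -
  have "rademacher m k \<in> borel_measurable (vilenkin m)" for k
    unfolding rademacher_def[abs_def]
    by (rule measurable_compose[OF measurable_coordinate]) simp
  then show ?thesis
    unfolding psi_def[abs_def] by (intro borel_measurable_prod borel_measurable_power)
qed

lemma sum_roots_of_unity: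
  fixes z :: complex
  assumes "z ^ q = 1" "z \<noteq> 1"
  shows "(\<Sum>t<q. z ^ t) = 0"
  using assms by (simp add: sum_gp_strict)

lemma rademacher_eq_1_iff:
  assumes "x \<in> space (vilenkin m)"
  shows "rademacher m k x = 1 \<longleftrightarrow> x k = 0"
proof -
  have "x k < m k" using assms by (simp add: space_vilenkin)
  then show ?thesis
    using complex_root_unity_eq[of "m k" "x k" 0] by (simp add: rademacher_def cong_def)
qed

lemma rademacher_power: "rademacher m k x ^ m k = 1"
  using complex_root_unity[of "m k" "x k"] ge2[of k] by (simp add: rademacher_def)

text \<open>
  Coordinates are independent and uniformly distributed. All integrals over the group that are computed below
  reduce to this formula.
\<close>

lemma integral_prod_coordinates:
  fixes h :: "nat \<Rightarrow> nat \<Rightarrow> complex"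
  shows "(\<integral>x. (\<Prod>j<N. h j (x j)) \<partial>vilenkin m) = (\<Prod>j<N. (\<Sum>t<m j. h j t) / of_nat (m j))"
proof -
  let ?M = "\<lambda>k. uniform_count_measure {..<m k}"
  \<comment> \<open>Project the infinite product onto its first \<open>N\<close> factors and use Fubini there.\<close>
  have ps: "prob_space (?M k)" for k
    using ge2[of k] by (intro prob_space_uniform_count_measure) (auto simp: lessThan_empty_iff)
  interpret P: product_prob_space ?M UNIV
    by (intro product_prob_spaceI ps)
  have int: "integrable (?M j) (h j)" for j
    by (simp add: uniform_count_measure_def integrable_point_measure_finite)
  have single: "integral\<^sup>L (?M j) (h j) = (\<Sum>t<m j. h j t) / of_nat (m j)" for j
    by (simp add: uniform_count_measure_def lebesgue_integral_point_measure_finite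
        scaleR_conv_of_real sum_divide_distrib)
  have meas: "(\<lambda>x. \<Prod>j<N. h j (x j)) \<in> borel_measurable (Pi\<^sub>M {..<N} ?M)"
    by (intro borel_measurable_prod measurable_compose[OF measurable_component_singleton]
         borel_measurable_integrable[OF int])
  have "(\<integral>x. (\<Prod>j<N. h j (x j)) \<partial>vilenkin m)
      = (\<integral>x. (\<Prod>j<N. h j (restrict x {..<N} j)) \<partial>vilenkin m)"
    by simp
  also have "\<dots> = (\<integral>x. (\<Prod>j<N. h j (x j)) \<partial>distr (vilenkin m) (Pi\<^sub>M {..<N} ?M) (\<lambda>x. restrict x {..<N}))"
    unfolding vilenkin_def
    by (rule integral_distr[symmetric, OF _ meas]) (intro measurable_restrict_subset, simp)
  also have "distr (vilenkin m) (Pi\<^sub>M {..<N} ?M) (\<lambda>x. restrict x {..<N}) = Pi\<^sub>M {..<N} ?M"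
    unfolding vilenkin_def by (rule P.distr_PiM_restrict_finite) auto
  also have "(\<integral>x. (\<Prod>j<N. h j (x j)) \<partial>Pi\<^sub>M {..<N} ?M) = (\<Prod>j<N. integral\<^sup>L (?M j) (h j))"
    by (rule P.product_integral_prod) (auto intro: int)
  finally show ?thesis by (simp only: single)
qed

text \<open>
  By independence the integral factors over the coordinates. The factor at \<open>j\<close> is a mean of powers of an
  \<open>m j\<close>-th root of unity, which vanishes unless \<open>i\<close> and \<open>k\<close> have the same \<open>j\<close>-th digit.
\<close>

lemma psi_orthonormal:
  "(\<integral>x. psi m i x * cnj (psi m k x) \<partial>vilenkin m) = (if i = k then 1 else 0)"
proof -
  define \<omega> where "\<omega> j t = exp (2 * of_real pi * \<i> * of_nat t / of_nat (m j))" for j t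
  define N where "N = max i k"
  have N: "i < gen_pow m N" "k < gen_pow m N"
    using gen_pow_gt[of m N, OF ge2] by (auto simp: N_def)
  let ?h = "\<lambda>j t. \<omega> j t ^ digit m i j * cnj (\<omega> j t ^ digit m k j)"
  have "psi m i x * cnj (psi m k x) = (\<Prod>j<N. ?h j (x j))" for x
    by (simp add: psi_eq_prod[OF N(1)] psi_eq_prod[OF N(2)] prod.distrib rademacher_def \<omega>_def)
  then have "(\<integral>x. psi m i x * cnj (psi m k x) \<partial>vilenkin m)
      = (\<Prod>j<N. (\<Sum>t<m j. ?h j t) / of_nat (m j))"
    using integral_prod_coordinates[of ?h N] by (simp only:)
  also have "\<dots> = (\<Prod>j<N. if digit m i j = digit m k j then 1 else 0)"
  proof (rule prod.cong)
    fix j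
    define z where "z = \<omega> j (digit m i j) * cnj (\<omega> j (digit m k j))"
    \<comment> \<open>Exchanging argument and exponent turns the sum over \<open>t\<close> into a geometric one with ratio \<open>z\<close>.\<close>
    have swap: "\<omega> j t ^ d = \<omega> j d ^ t" for t d
      by (simp add: \<omega>_def exp_of_nat_mult[symmetric] ac_simps)
    have cnj_inv: "\<omega> j d * cnj (\<omega> j d) = 1" for d
      unfolding \<omega>_def by (simp add: exp_cnj exp_add[symmetric])
    have h: "?h j t = z ^ t" for t
      unfolding swap[of t "digit m i j"] swap[of t "digit m k j"]
      by (simp add: z_def power_mult_distrib)
    have root: "\<omega> j d ^ m j = 1" for d
      using complex_root_unity[of "m j" d] ge2[of j] by (simp add: \<omega>_def)
    have zm: "z ^ m j = 1"
      by (simp add: z_def power_mult_distrib complex_cnj_power[symmetric] root del: complex_cnj_power)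
    show "(\<Sum>t<m j. ?h j t) / of_nat (m j) = (if digit m i j = digit m k j then 1 else 0)"
    proof (cases "digit m i j = digit m k j")
      case True
      then have "z = 1" by (simp add: z_def cnj_inv)
      then show ?thesis unfolding h using True ge2[of j] by simp
    next
      case False
      have "z \<noteq> 1"
      proof
        assume "z = 1"
        then have "\<omega> j (digit m i j) = \<omega> j (digit m k j)"
          using cnj_inv[of "digit m k j"] unfolding z_def
          by (metis mult.assoc mult.commute mult.right_neutral)
        then show False
          using False complex_root_unity_eq[of "m j"] ge2[of j] digit_less[of m _ j, OF ge2]
          by (auto simp: \<omega>_def cong_def)
      qed
      with sum_roots_of_unity[OF zm] show ?thesis
        unfolding h using False by simp
    qed
  qed simp
  also have "\<dots> = (if i = k then 1 else 0)"
  proof (cases "i = k")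
    case False
    then obtain j where j: "digit m i j \<noteq> digit m k j"
      using digits_inject by blast
    then have "j < N"
      using digit_eq_0_beyond[OF N(1)] digit_eq_0_beyond[OF N(2)] by (metis not_less)
    then show ?thesis using j False by auto
  qed simp
  finally show ?thesis .
qed

section \<open>Dirichlet kernels and blocks\<close>

definition dirichlet :: "nat \<Rightarrow> (nat \<Rightarrow> nat) \<Rightarrow> complex" where
  "dirichlet n x = (\<Sum>i<n. psi m i x)"

definition near_origin :: "nat \<Rightarrow> (nat \<Rightarrow> nat) \<Rightarrow> real" where
  "near_origin n x = of_bool (\<forall>j<n. x j = 0)"

text \<open>
  The blocks of the Vilenkin system between consecutive \<open>M n\<close>: they are the martingale differences of the formal
  series \<open>\<Sum>i. psi m i\<close>.
\<close>

definition block :: "nat \<Rightarrow> (nat \<Rightarrow> nat) \<Rightarrow> complex" where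
  "block n x = dirichlet (gen_pow m (Suc n)) x - dirichlet (gen_pow m n) x"

lemma dirichlet_add:
  assumes "A \<le> gen_pow m n"
  shows "dirichlet (q * gen_pow m n + A) x
    = dirichlet (q * gen_pow m n) x + psi m (q * gen_pow m n) x * dirichlet A x"
  using assms
proof (induction A)
  case (Suc A)
  then show ?case
    using psi_add[of A n q x] by (simp add: dirichlet_def algebra_simps)
qed (simp add: dirichlet_def)

lemma dirichlet_multiple:
  "dirichlet (q * gen_pow m n) x = (\<Sum>a<q. psi m (a * gen_pow m n) x) * dirichlet (gen_pow m n) x"
proof (induction q)
  case (Suc q)
  then show ?case
    using dirichlet_add[of "gen_pow m n" n q x] by (simp add: algebra_simps)
qed (simp add: dirichlet_def)

text \<open>
  The first \<open>M n\<close> Vilenkin functions involve only the first \<open>n\<close> coordinates, so they are \<open>1\<close> where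
  these vanish.
\<close>

lemma dirichlet_near_origin:
  assumes "\<And>j. j < n \<Longrightarrow> x j = 0" "A \<le> gen_pow m n"
  shows "dirichlet A x = of_nat A"
proof -
  have "psi m i x = 1" if "i < A" for i
  proof -
    have "i < gen_pow m n" using that assms(2) by simp
    then have "psi m i x = (\<Prod>j<n. rademacher m j x ^ digit m i j)"
      by (rule psi_eq_prod)
    also have "\<dots> = 1"
      by (intro prod.neutral) (simp add: rademacher_def assms(1))
    finally show ?thesis .
  qed
  then show ?thesis by (simp add: dirichlet_def)
qed

text \<open>
  \<open>D (M n)\<close> is the product over \<open>j < n\<close> of the full geometric sums of the powers of \<open>rademacher m j\<close>, and
  a coordinate \<open>x j \<noteq> 0\<close> makes the \<open>j\<close>-th of them a sum over nontrivial roots of unity.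
\<close>

lemma dirichlet_gen_pow_eq_0:
  assumes "x \<in> space (vilenkin m)" "j < n" "x j \<noteq> 0"
  shows "dirichlet (gen_pow m n) x = 0"
  using assms(2)
proof (induction n)
  case (Suc n)
  have eq: "dirichlet (gen_pow m (Suc n)) x
      = (\<Sum>a<m n. rademacher m n x ^ a) * dirichlet (gen_pow m n) x"
    using dirichlet_multiple[of "m n" n x] by (simp add: psi_mult_gen_pow)
  show ?case
  proof (cases "j = n")
    case True
    then have "(\<Sum>a<m n. rademacher m n x ^ a) = 0"
      using assms by (intro sum_roots_of_unity rademacher_power) (simp add: rademacher_eq_1_iff)
    then show ?thesis unfolding eq by simp
  next
    case False
    then show ?thesis unfolding eq using Suc by simp
  qed
qed simp

lemma dirichlet_gen_pow:
  assumes "x \<in> space (vilenkin m)"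
  shows "dirichlet (gen_pow m n) x = of_real (real (gen_pow m n) * near_origin n x)"
  using dirichlet_near_origin[of n x "gen_pow m n"] dirichlet_gen_pow_eq_0[OF assms, of _ n]
  by (auto simp: near_origin_def)

text \<open>
  Cut \<open>{..<k}\<close> into segments of length \<open>M (s + 1)\<close>. On the shell the full segments cancel. The
  remaining one has at most \<open>M s\<close> terms, so up to a unimodular factor all of its terms are \<open>1\<close>. This pointwise
  identity replaces any estimate of Lebesgue constants.
\<close>

lemma norm_dirichlet_shell:
  assumes "x \<in> space (vilenkin m)" "\<And>j. j < s \<Longrightarrow> x j = 0" "x s \<noteq> 0"
    and "k mod gen_pow m (Suc s) \<le> gen_pow m s"
  shows "cmod (dirichlet k x) = real (k mod gen_pow m (Suc s))"
proof -
  let ?L = "gen_pow m (Suc s)"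
  have le: "k mod ?L \<le> ?L" using gen_pow_pos[of "Suc s"] by (simp del: gen_pow.simps)
  have "dirichlet k x = dirichlet (k div ?L * ?L + k mod ?L) x"
    by (simp only: div_mult_mod_eq)
  also have "\<dots> = psi m (k div ?L * ?L) x * dirichlet (k mod ?L) x"
    unfolding dirichlet_add[OF le] dirichlet_multiple[of _ "Suc s"]
    using dirichlet_gen_pow_eq_0[OF assms(1), of s "Suc s"] assms(3) by simp
  also have "dirichlet (k mod ?L) x = of_nat (k mod ?L)"
    by (rule dirichlet_near_origin[OF assms(2,4)])
  finally show ?thesis by (simp add: norm_mult del: gen_pow.simps)
qed

lemma measurable_dirichlet [measurable]: "dirichlet n \<in> borel_measurable (vilenkin m)"
  unfolding dirichlet_def[abs_def] by measurable

lemma measurable_block [measurable]: "block n \<in> borel_measurable (vilenkin m)"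
  unfolding block_def[abs_def] by measurable

lemma norm_dirichlet_le: "cmod (dirichlet n x) \<le> real n"
  unfolding dirichlet_def using norm_sum[of "\<lambda>i. psi m i x" "{..<n}"] by simp

lemma integrable_dirichlet: "integrable (vilenkin m) (dirichlet n)"
  by (rule integrable_const_bound[of _ "real n"]) (auto simp: norm_dirichlet_le)

lemma integrable_block: "integrable (vilenkin m) (block n)"
  unfolding block_def[abs_def] by (intro Bochner_Integration.integrable_diff integrable_dirichlet)

lemma measurable_near_origin [measurable]: "near_origin n \<in> borel_measurable (vilenkin m)"
proof -
  have "near_origin n = (\<lambda>x. (\<lambda>l. of_bool (\<forall>a\<in>set l. a = 0)) (map x [0..<n]))"
    by (auto simp: near_origin_def fun_eq_iff)
  then show ?thesis
    by (simp only:) (rule measurable_compose[OF measurable_prefix], simp)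
qed

lemma integrable_near_origin: "integrable (vilenkin m) (near_origin n)"
  by (rule integrable_const_bound[of _ 1]) (auto simp: near_origin_def)

lemma measurable_cnj_psi [measurable]: "(\<lambda>x. cnj (psi m n x)) \<in> borel_measurable (vilenkin m)"
  by (rule measurable_compose[OF measurable_psi])
    (intro borel_measurable_continuous_onI continuous_intros)

lemma fourier_coeff_dirichlet: "fourier_coeff m (dirichlet n) k = of_bool (k < n)"
proof -
  have int: "integrable (vilenkin m) (\<lambda>x. psi m i x * cnj (psi m k x))" for i
    by (rule integrable_const_bound[of _ 1]) (auto simp: norm_mult)
  have "fourier_coeff m (dirichlet n) k = (\<Sum>i<n. \<integral>x. psi m i x * cnj (psi m k x) \<partial>vilenkin m)"
    unfolding fourier_coeff_def dirichlet_def sum_distrib_right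
    by (rule Bochner_Integration.integral_sum) (rule int)
  also have "\<dots> = of_bool (k < n)"
    by (simp add: psi_orthonormal)
  finally show ?thesis .
qed

lemma psi_0: "psi m 0 x = 1"
  by (simp add: psi_def digit_def)

lemma integral_dirichlet:
  assumes "n > 0"
  shows "(\<integral>x. dirichlet n x \<partial>vilenkin m) = 1"
  using fourier_coeff_dirichlet[of n 0] assms by (simp add: fourier_coeff_def psi_0)

text \<open>
  Obtained from \<open>D (M n) = M n\<close> on \<open>I n\<close> and the mean value \<open>1\<close> of every nonzero Dirichlet kernel.
\<close>

lemma integral_near_origin: "(\<integral>x. near_origin n x \<partial>vilenkin m) = 1 / real (gen_pow m n)"
proof -
  have "1 = (\<integral>x. dirichlet (gen_pow m n) x \<partial>vilenkin m)"
    by (simp add: integral_dirichlet gen_pow_pos)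
  also have "\<dots> = (\<integral>x. complex_of_real (real (gen_pow m n) * near_origin n x) \<partial>vilenkin m)"
    by (rule Bochner_Integration.integral_cong) (auto simp: dirichlet_gen_pow)
  also have "\<dots> = of_real (real (gen_pow m n) * (\<integral>x. near_origin n x \<partial>vilenkin m))"
    unfolding integral_complex_of_real by simp
  finally have "real (gen_pow m n) * (\<integral>x. near_origin n x \<partial>vilenkin m) = 1"
    by (metis of_real_eq_1_iff)
  then show ?thesis using gen_pow_pos[of n] by (simp add: field_simps)
qed

lemma L1_norm_block_le: "(\<integral>x. cmod (block n x) \<partial>vilenkin m) \<le> 2"
proof -
  have "(\<integral>x. cmod (block n x) \<partial>vilenkin m)
      \<le> (\<integral>x. real (gen_pow m (Suc n)) * near_origin (Suc n) x
             + real (gen_pow m n) * near_origin n x \<partial>vilenkin m)"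
  proof (rule integral_mono)
    fix x assume x: "x \<in> space (vilenkin m)"
    show "cmod (block n x) \<le> real (gen_pow m (Suc n)) * near_origin (Suc n) x
             + real (gen_pow m n) * near_origin n x"
      unfolding block_def dirichlet_gen_pow[OF x]
      by (rule order_trans[OF norm_triangle_ineq4]) (simp add: norm_mult near_origin_def)
  qed (intro integrable_norm integrable_block Bochner_Integration.integrable_add
        integrable_mult_right integrable_near_origin)+
  also have "\<dots> = 2"
    using gen_pow_pos[of n] gen_pow_pos[of "Suc n"]
    by (simp add: integrable_near_origin integral_near_origin del: gen_pow.simps)
  finally show ?thesis .
qed

lemma fourier_coeff_block:
  "fourier_coeff m (block n) k = of_bool (gen_pow m n \<le> k \<and> k < gen_pow m (Suc n))"
proof -
  have int: "integrable (vilenkin m) (\<lambda>x. dirichlet i x * cnj (psi m k x))" for i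
    by (rule integrable_const_bound[of _ "real i"]) (auto simp: norm_mult norm_dirichlet_le)
  have "fourier_coeff m (block n) k
      = fourier_coeff m (dirichlet (gen_pow m (Suc n))) k - fourier_coeff m (dirichlet (gen_pow m n)) k"
    unfolding fourier_coeff_def block_def left_diff_distrib
    by (rule Bochner_Integration.integral_diff) (rule int)+
  then show ?thesis
    using gen_pow_mono[of n "Suc n"] by (auto simp: fourier_coeff_dirichlet simp del: gen_pow.simps)
qed

lemma measurable_cylinder [measurable]: "cylinder m n x \<in> sets (vilenkin m)"
proof -
  have "cylinder m n x = (\<lambda>y. map y [0..<n]) -` {map x [0..<n]} \<inter> space (vilenkin m)"
    by (auto simp: cylinder_def)
  then show ?thesis
    using measurable_sets[OF measurable_prefix] by simp
qed

lemma block_cong: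
  assumes "x \<in> space (vilenkin m)" "y \<in> space (vilenkin m)" "\<And>j. j \<le> n \<Longrightarrow> y j = x j"
  shows "block n y = block n x"
  using assms unfolding block_def by (simp add: dirichlet_gen_pow near_origin_def del: gen_pow.simps)

lemma block_eq_0:
  assumes "x \<in> space (vilenkin m)" "j < n" "x j \<noteq> 0"
  shows "block n x = 0"
  using assms dirichlet_gen_pow_eq_0[of x j n] dirichlet_gen_pow_eq_0[of x j "Suc n"]
  by (simp add: block_def del: gen_pow.simps)

text \<open>
  The martingale difference property. A block is constant on cylinders of order \<open>k > n\<close>. A cylinder of
  order \<open>k \<le> n\<close> either contains the support \<open>I n\<close> of the block, whose mean is \<open>0\<close>, or misses it.
\<close>

lemma norm_integral_block_cylinder_le:
  assumes x: "x \<in> space (vilenkin m)"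
  shows "cmod (\<integral>y\<in>cylinder m k x. block n y \<partial>vilenkin m)
    \<le> measure (vilenkin m) (cylinder m k x) * cmod (block n x)"
proof (cases "n < k")
  case True
  have "(\<integral>y\<in>cylinder m k x. block n y \<partial>vilenkin m)
      = (\<integral>y. indicator (cylinder m k x) y *\<^sub>R block n x \<partial>vilenkin m)"
    unfolding set_lebesgue_integral_def
    using block_cong[OF x, of _ n] True
    by (intro Bochner_Integration.integral_cong) (auto simp: indicator_def cylinder_def)
  also have "\<dots> = measure (vilenkin m) (cylinder m k x) *\<^sub>R block n x"
    by (subst integral_scaleR_left) (auto simp: emeasure_eq_measure)
  finally show ?thesis by simp
next
  case False
  have "(\<integral>y\<in>cylinder m k x. block n y \<partial>vilenkin m) = 0"
  proof (cases "\<forall>j<k. x j = 0")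
    case True
    have "(\<integral>y\<in>cylinder m k x. block n y \<partial>vilenkin m) = (\<integral>y. block n y \<partial>vilenkin m)"
      unfolding set_lebesgue_integral_def
    proof (rule Bochner_Integration.integral_cong)
      fix y assume y: "y \<in> space (vilenkin m)"
      show "indicator (cylinder m k x) y *\<^sub>R block n y = block n y"
      proof (cases "y \<in> cylinder m k x")
        case outside: False
        then obtain j where "j < k" "y j \<noteq> 0"
          using y True by (auto simp: cylinder_def)
        then show ?thesis using block_eq_0[OF y, of j n] False by simp
      qed simp
    qed simp
    also have "\<dots> = 0"
      unfolding block_def
      by (subst Bochner_Integration.integral_diff)
        (simp_all add: integrable_dirichlet integral_dirichlet gen_pow_pos del: gen_pow.simps)
    finally show ?thesis .
  next
    case outside: False
    then obtain j where j: "j < k" "x j \<noteq> 0" by auto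
    have "(\<integral>y\<in>cylinder m k x. block n y \<partial>vilenkin m) = (\<integral>y. 0 \<partial>vilenkin m)"
      unfolding set_lebesgue_integral_def
      using block_eq_0[of _ j n] j False
      by (intro Bochner_Integration.integral_cong) (auto simp: indicator_def cylinder_def)
    then show ?thesis by simp
  qed
  then show ?thesis by simp
qed

section \<open>Weighted series of blocks in the Hardy space\<close>

text \<open>
  At the origin the series can diverge; it converges almost everywhere when \<open>c\<close> is summable, and the value that
  \<open>suminf\<close> takes on the exceptional null set does not affect any integral.
\<close>

definition block_series :: "(nat \<Rightarrow> real) \<Rightarrow> (nat \<Rightarrow> nat) \<Rightarrow> complex" where
  "block_series c x = (\<Sum>n. of_real (c n) * block n x)"

context
  fixes c :: "nat \<Rightarrow> real"
  assumes c_nonneg: "\<And>n. c n \<ge> 0" and c_summable: "summable c"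
begin

lemma summable_integral_norm_blocks:
  "summable (\<lambda>n. \<integral>x. c n * cmod (block n x) \<partial>vilenkin m)"
proof (rule summable_comparison_test'[of "\<lambda>n. 2 * c n" 0])
  show "summable (\<lambda>n. 2 * c n)" using c_summable by (rule summable_mult)
  show "norm (\<integral>x. c n * cmod (block n x) \<partial>vilenkin m) \<le> 2 * c n" for n
    using mult_left_mono[OF L1_norm_block_le c_nonneg[of n], of n] c_nonneg[of n]
    by (simp add: abs_mult mult.commute)
qed

lemma AE_summable_blocks: "AE x in vilenkin m. summable (\<lambda>n. c n * cmod (block n x))"
proof -
  have int: "integrable (vilenkin m) (\<lambda>x. c n * cmod (block n x))" for n
    by (intro integrable_mult_right integrable_norm integrable_block)
  have "(\<integral>\<^sup>+x. (\<Sum>n. ennreal (c n * cmod (block n x))) \<partial>vilenkin m)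
      = (\<Sum>n. \<integral>\<^sup>+x. ennreal (c n * cmod (block n x)) \<partial>vilenkin m)"
    by (rule nn_integral_suminf) measurable
  also have "\<dots> = (\<Sum>n. ennreal (\<integral>x. c n * cmod (block n x) \<partial>vilenkin m))"
    by (intro arg_cong[where f = suminf] ext nn_integral_eq_integral int) (simp add: c_nonneg)
  also have "\<dots> \<noteq> \<infinity>"
    using summable_integral_norm_blocks
    by (simp add: ennreal_suminf_neq_top integral_nonneg_AE c_nonneg)
  finally have "AE x in vilenkin m. (\<Sum>n. ennreal (c n * cmod (block n x))) \<noteq> \<infinity>"
    by (intro nn_integral_PInf_AE) measurable
  then show ?thesis
    by eventually_elim (rule summable_suminf_not_top, auto simp: c_nonneg)
qed

text \<open>
  Termwise integration against a bounded function. It is applied with \<open>g\<close> a conjugate Vilenkin function for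
  the Fourier coefficients, an indicator function for the maximal function, and a constant for integrability.
\<close>

lemma sums_integral_block_series:
  assumes g [measurable]: "g \<in> borel_measurable (vilenkin m)"
    and bound: "\<And>x. cmod (g x) \<le> 1"
  shows "(\<lambda>n. of_real (c n) * (\<integral>x. block n x * g x \<partial>vilenkin m))
      sums (\<integral>x. block_series c x * g x \<partial>vilenkin m)"
    and "integrable (vilenkin m) (\<lambda>x. block_series c x * g x)"
proof -
  have le: "cmod (block n x * g x) \<le> cmod (block n x)" for n x
    using bound[of x] by (simp add: norm_mult mult_left_le)
  have int: "integrable (vilenkin m) (\<lambda>x. block n x * g x)" for n
    by (rule Bochner_Integration.integrable_bound[OF integrable_block[of n]]) (auto simp: le)
  have int': "integrable (vilenkin m) (\<lambda>x. of_real (c n) * (block n x * g x))" for n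
    by (intro integrable_mult_right int)
  have norm_le: "cmod (of_real (c n) * (block n x * g x)) \<le> c n * cmod (block n x)" for n x
    using mult_left_mono[OF le c_nonneg] by (simp add: norm_mult c_nonneg)
  have AE: "AE x in vilenkin m. summable (\<lambda>n. cmod (of_real (c n) * (block n x * g x)))"
    using AE_summable_blocks
  proof eventually_elim
    case (elim x)
    then show ?case by (rule summable_comparison_test'[of _ 0]) (use norm_le in auto)
  qed
  have sums: "summable (\<lambda>n. \<integral>x. cmod (of_real (c n) * (block n x * g x)) \<partial>vilenkin m)"
  proof (rule summable_comparison_test'[OF summable_integral_norm_blocks, of 0])
    fix n
    have "(\<integral>x. cmod (of_real (c n) * (block n x * g x)) \<partial>vilenkin m)
        \<le> (\<integral>x. c n * cmod (block n x) \<partial>vilenkin m)"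
      by (intro integral_mono integrable_norm int' norm_le integrable_mult_right integrable_block)
    moreover have "(\<integral>x. cmod (of_real (c n) * (block n x * g x)) \<partial>vilenkin m) \<ge> 0"
      by (intro integral_nonneg_AE AE_I2 norm_ge_zero)
    ultimately show "norm (\<integral>x. cmod (of_real (c n) * (block n x * g x)) \<partial>vilenkin m)
        \<le> (\<integral>x. c n * cmod (block n x) \<partial>vilenkin m)"
      by (simp only: real_norm_def abs_of_nonneg)
  qed
  have AE_eq: "AE x in vilenkin m. block_series c x * g x
      = (\<Sum>n. of_real (c n) * (block n x * g x))"
    using AE_summable_blocks
  proof eventually_elim
    case (elim x)
    then have "summable (\<lambda>n. cmod (of_real (c n) * block n x))"
      by (simp add: norm_mult c_nonneg)
    then have "summable (\<lambda>n. of_real (c n) * block n x)"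
      by (rule summable_norm_cancel)
    then show ?case
      unfolding block_series_def by (subst suminf_mult2) (simp_all add: ac_simps)
  qed
  have meas: "(\<lambda>x. block_series c x * g x) \<in> borel_measurable (vilenkin m)"
    unfolding block_series_def by measurable
  have "(\<lambda>n. \<integral>x. of_real (c n) * (block n x * g x) \<partial>vilenkin m)
      sums (\<integral>x. (\<Sum>n. of_real (c n) * (block n x * g x)) \<partial>vilenkin m)"
    by (rule sums_integral[OF int' AE sums])
  also have "(\<integral>x. (\<Sum>n. of_real (c n) * (block n x * g x)) \<partial>vilenkin m)
      = (\<integral>x. block_series c x * g x \<partial>vilenkin m)"
    using AE_eq by (intro integral_cong_AE meas) auto
  finally show "(\<lambda>n. of_real (c n) * (\<integral>x. block n x * g x \<partial>vilenkin m))
      sums (\<integral>x. block_series c x * g x \<partial>vilenkin m)" by simp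
  show "integrable (vilenkin m) (\<lambda>x. block_series c x * g x)"
    using integrable_suminf[OF int' AE sums] AE_eq
    by (subst integrable_cong_AE[OF meas]) auto
qed

lemma integrable_block_series: "integrable (vilenkin m) (block_series c)"
  using sums_integral_block_series(2)[of "\<lambda>_. 1"] by simp

lemma sums_fourier_coeff_block_series:
  "(\<lambda>n. of_real (c n) * of_bool (gen_pow m n \<le> k \<and> k < gen_pow m (Suc n)))
    sums fourier_coeff m (block_series c) k"
  using sums_integral_block_series(1)[of "\<lambda>x. cnj (psi m k x)"]
  unfolding fourier_coeff_def[symmetric] by (simp add: fourier_coeff_block del: gen_pow.simps)

lemma fourier_coeff_block_series:
  assumes "gen_pow m N \<le> k" "k < gen_pow m (Suc N)"
  shows "fourier_coeff m (block_series c) k = of_real (c N)"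
proof -
  have iff: "gen_pow m n \<le> k \<and> k < gen_pow m (Suc n) \<longleftrightarrow> n = N" for n
    using assms gen_pow_mono[of "Suc n" N] gen_pow_mono[of "Suc N" n]
    by (cases n N rule: linorder_cases) (auto simp del: gen_pow.simps)
  have "(\<lambda>n. of_real (c n) * of_bool (n = N)) = (\<lambda>n. if n = N then complex_of_real (c N) else 0)"
    by auto
  then have "(\<lambda>n. if n = N then complex_of_real (c N) else 0)
      sums fourier_coeff m (block_series c) k"
    using sums_fourier_coeff_block_series[of k] by (simp only: iff)
  with sums_single[of N "\<lambda>_. complex_of_real (c N)"] show ?thesis
    by (rule sums_unique2[symmetric])
qed

text \<open>
  The index \<open>0\<close> lies before the first block, because \<open>M 0 = 1\<close>.
\<close>

lemma fourier_coeff_block_series_0: "fourier_coeff m (block_series c) 0 = 0"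
proof -
  have "(\<lambda>n. 0) sums fourier_coeff m (block_series c) 0"
    using sums_fourier_coeff_block_series[of 0] gen_pow_pos[THEN gr_implies_not0]
    by (simp del: gen_pow.simps)
  then show ?thesis by (rule sums_unique2[OF _ sums_zero])
qed

lemma partial_sum_block_series_within:
  assumes "gen_pow m N \<le> k" "k \<le> gen_pow m (Suc N)"
  shows "partial_sum m (block_series c) k x = partial_sum m (block_series c) (gen_pow m N) x
      + of_real (c N) * (dirichlet k x - dirichlet (gen_pow m N) x)"
  using assms
proof (induction rule: dec_induct)
  case (step k)
  then show ?case
    using fourier_coeff_block_series[of N k]
    by (simp add: partial_sum_def dirichlet_def algebra_simps del: gen_pow.simps)
qed simp

lemma partial_sum_block_series_gen_pow:
  "partial_sum m (block_series c) (gen_pow m N) x = (\<Sum>n<N. of_real (c n) * block n x)"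
proof (induction N)
  case 0
  then show ?case by (simp add: partial_sum_def fourier_coeff_block_series_0)
next
  case (Suc N)
  then show ?case
    using partial_sum_block_series_within[of N "gen_pow m (Suc N)" x] gen_pow_mono[of N "Suc N"]
    by (simp add: block_def del: gen_pow.simps)
qed

text \<open>
  Every cylinder mean of the series at \<open>x\<close> is bounded by \<open>\<Sum>n. c n * \<bar>block n x\<bar>\<close>, because this holds
  termwise. The bound is free of the order of the cylinder and integrable in \<open>x\<close>.
\<close>

lemma block_series_in_H1: "block_series c \<in> H1 m"
proof -
  let ?B = "\<lambda>x. \<Sum>n. c n * cmod (block n x)"
  have "AE x in vilenkin m. maximal_fun m (block_series c) x \<le> ennreal (?B x)"
    using AE_summable_blocks AE_space
  proof eventually_elim
    case (elim x)
    have "1 / measure (vilenkin m) (cylinder m k x)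
        * cmod (\<integral>y\<in>cylinder m k x. block_series c y \<partial>vilenkin m) \<le> ?B x" for k
    proof -
      let ?\<mu> = "measure (vilenkin m) (cylinder m k x)"
      let ?a = "\<lambda>n. of_real (c n) * (\<integral>y\<in>cylinder m k x. block n y \<partial>vilenkin m)"
      have a: "?a sums (\<integral>y\<in>cylinder m k x. block_series c y \<partial>vilenkin m)"
        using sums_integral_block_series(1)[of "\<lambda>y. of_real (indicator (cylinder m k x) y)"]
        by (simp add: set_lebesgue_integral_def scaleR_conv_of_real mult.commute)
      have a_le: "cmod (?a n) \<le> ?\<mu> * (c n * cmod (block n x))" for n
        using mult_left_mono[OF norm_integral_block_cylinder_le[OF elim(2), of k n] c_nonneg[of n]]
        by (simp add: norm_mult c_nonneg ac_simps)
      have "summable (\<lambda>n. ?\<mu> * (c n * cmod (block n x)))"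
        using elim(1) by (rule summable_mult)
      then have "cmod (suminf ?a) \<le> (\<Sum>n. ?\<mu> * (c n * cmod (block n x)))"
        using a_le by (intro norm_suminf_le)
      then have "cmod (\<integral>y\<in>cylinder m k x. block_series c y \<partial>vilenkin m) \<le> ?\<mu> * ?B x"
        using sums_unique[OF a] suminf_mult[OF elim(1), of ?\<mu>] by simp
      moreover have "?B x \<ge> 0"
        using elim(1) by (intro suminf_nonneg) (auto simp: c_nonneg)
      ultimately show ?thesis
        by (cases "?\<mu> = 0") (auto simp: field_simps zero_less_measure_iff)
    qed
    then show ?case
      unfolding maximal_fun_def by (intro SUP_least ennreal_leI)
  qed
  then have "H1_norm m (block_series c) \<le> (\<integral>\<^sup>+x. ennreal (?B x) \<partial>vilenkin m)"
    unfolding H1_norm_def by (rule nn_integral_mono_AE)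
  also have "\<dots> < \<infinity>"
  proof -
    have "integrable (vilenkin m) ?B"
      using summable_integral_norm_blocks AE_summable_blocks
      by (intro integrable_suminf integrable_mult_right integrable_norm integrable_block)
        (simp_all add: c_nonneg abs_mult)
    then have "(\<integral>\<^sup>+x. norm (?B x) \<partial>vilenkin m) < \<infinity>"
      by (simp add: integrable_iff_bounded)
    moreover have "(\<integral>\<^sup>+x. ennreal (?B x) \<partial>vilenkin m) \<le> (\<integral>\<^sup>+x. norm (?B x) \<partial>vilenkin m)"
      by (intro nn_integral_mono ennreal_leI) simp
    ultimately show ?thesis by simp
  qed
  finally show ?thesis
    by (simp add: H1_def integrable_block_series)
qed

end

end

section \<open>Growth of the mean norms of partial sums\<close>

lemma sum_mod_multiple:
  fixes g :: "nat \<Rightarrow> 'a :: semiring_1"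
  shows "(\<Sum>k<q * L. g (k mod L)) = of_nat q * (\<Sum>b<L. g b)"
proof (induction q)
  case (Suc q)
  have "(\<Sum>k<Suc q * L. g (k mod L)) = (\<Sum>k<q * L. g (k mod L)) + (\<Sum>k=q * L..<q * L + L. g (k mod L))"
    by (subst sum.atLeastLessThan_concat[of 0, symmetric, unfolded atLeast0LessThan])
      (simp_all add: add.commute)
  also have "(\<Sum>k=q * L..<q * L + L. g (k mod L)) = (\<Sum>b<L. g b)"
    using sum.shift_bounds_nat_ivl[of "\<lambda>k. g (k mod L)" 0 "q * L" L]
    by (simp add: add.commute atLeast0LessThan)
  finally show ?case using Suc by (simp add: algebra_simps)
qed simp

text \<open>
  A lacunary sequence: weight \<open>1 / 2 ^ j\<close> at the position \<open>4 ^ j\<close>, and \<open>0\<close> elsewhere.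
\<close>

lemma exists_summable_weight:
  "\<exists>c :: nat \<Rightarrow> real. (\<forall>n. c n \<ge> 0) \<and> summable c \<and> (\<forall>K. \<exists>N. c N * (real N - 1) \<ge> K)"
proof -
  define c where "c n = (if n \<in> range (\<lambda>j. 4 ^ j) then 1 / sqrt (real n) else 0)" for n :: nat
  have c_pow: "c (4 ^ j) = (1 / 2) ^ j" for j
  proof -
    have "sqrt (4 ^ j) = (2::real) ^ j" by (simp add: real_sqrt_power)
    then show ?thesis by (simp add: c_def power_divide)
  qed
  have "strict_mono (\<lambda>j. 4 ^ j :: nat)" by (simp add: strict_mono_def)
  then have "summable (\<lambda>j. c (4 ^ j)) \<longleftrightarrow> summable c"
    by (rule summable_mono_reindex) (simp add: c_def)
  then have "summable c"
    by (simp add: c_pow summable_geometric)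
  moreover have "\<exists>N. c N * (real N - 1) \<ge> K" for K
  proof -
    obtain j :: nat where j: "K \<le> real j" using real_arch_simple by blast
    have "(4::real) ^ j = 2 ^ j * 2 ^ j" by (simp flip: power_mult_distrib)
    then have "c (4 ^ j) * (real (4 ^ j) - 1) = 2 ^ j - (1 / 2) ^ j"
      by (simp add: c_pow field_simps)
    also have "\<dots> \<ge> 2 ^ j - 1" by (simp add: power_le_one)
    also have "2 ^ j - 1 \<ge> real j"
    proof -
      have "Suc j \<le> 2 ^ j" using less_exp[of j] by (rule Suc_leI)
      then have "real (Suc j) \<le> real (2 ^ j)" by (rule of_nat_mono)
      then show ?thesis by simp
    qed
    finally show ?thesis using j by (intro exI[of _ "4 ^ j"]) linarith
  qed
  moreover have "c n \<ge> 0" for n by (simp add: c_def)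
  ultimately show ?thesis by blast
qed

context vilenkin_group
begin

text \<open>
  A lower bound for \<open>\<bar>D k\<bar>\<close> on the shell \<open>I s - I (s + 1)\<close>. The condition says that the \<open>s\<close>-th digit of
  \<open>k\<close> is \<open>0\<close>; the values of the kernel for other digits are discarded.
\<close>

definition shell_value :: "nat \<Rightarrow> nat \<Rightarrow> real" where
  "shell_value s k =
    (if k mod gen_pow m (Suc s) < gen_pow m s then real (k mod gen_pow m (Suc s)) else 0)"

lemma shell_value_le_norm_dirichlet:
  assumes "x \<in> space (vilenkin m)" "\<And>j. j < s \<Longrightarrow> x j = 0" "x s \<noteq> 0"
  shows "shell_value s k \<le> cmod (dirichlet k x)"
  unfolding shell_value_def using norm_dirichlet_shell[OF assms, of k] by (simp del: gen_pow.simps)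

text \<open>
  The summand has period \<open>M (s + 1)\<close> in \<open>k\<close>, and both ends of the range are multiples of it. Over one
  period it takes the values \<open>0, 1, \<dots>, M s - 1\<close> and then only \<open>0\<close>, which gives about \<open>(M s)\<^sup>2 / 2\<close>. For
  \<open>s = 0\<close> the sum vanishes, as \<open>M 0 = 1\<close>.
\<close>

lemma sum_shell_value:
  assumes "1 \<le> s" "s < N"
    and B: "\<And>k. m k \<le> B"
  shows "(\<Sum>k=gen_pow m N..<gen_pow m (Suc N). shell_value s k)
    \<ge> real (gen_pow m (Suc N)) * real (gen_pow m s) / (8 * real B)"
proof -
  let ?M = "gen_pow m s" and ?L = "gen_pow m (Suc s)"
  define g where "g b = (if b < ?M then real b else 0)" for b
  have g: "shell_value s k = g (k mod ?L)" for k
    by (simp add: shell_value_def g_def)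
  obtain p where p: "gen_pow m N = p * ?L"
    using gen_pow_dvd[of "Suc s" N] assms(2) by (auto simp: dvd_def mult.commute)
  have p': "gen_pow m (Suc N) = (m N * p) * ?L" by (simp add: p)
  have M2: "?M \<ge> 2" using gen_pow_gt[of m s, OF ge2] assms(1) by simp
  have sum_g: "(\<Sum>b<?L. g b) \<ge> real ?M * real ?M / 4"
  proof -
    have "real ?M * real ?M / 4 \<le> real ?M * (real ?M - 1) / 2"
    proof -
      have "real ?M * (real ?M - 1) / 2 - real ?M * real ?M / 4 = real ?M * (real ?M - 2) / 4"
        by (simp add: field_simps)
      moreover have "real ?M * (real ?M - 2) / 4 \<ge> 0" using M2 by simp
      ultimately show ?thesis by linarith
    qed
    also have "\<dots> = (\<Sum>b<?M. real b)"
      by (induction ("?M")) (auto simp: field_simps)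
    also have "\<dots> = (\<Sum>b<?M. g b)" by (simp add: g_def)
    also have "\<dots> = (\<Sum>b<?L. g b)"
      using gen_pow_mono[of s "Suc s"] by (intro sum.mono_neutral_left) (auto simp: g_def)
    finally show ?thesis .
  qed
  \<comment> \<open>The number of periods in the range; \<open>m N - 1\<close> is estimated by \<open>m N / 2\<close>.\<close>
  have count: "real (gen_pow m (Suc N)) / (2 * real B * real ?M) \<le> real (m N * p) - real p"
  proof -
    have Mpos: "real ?M > 0" using M2 by simp
    have "B > 0" using B[of 0] ge2[of 0] by simp
    have "real (m N * p) \<ge> 2 * real p"
      using mult_right_mono[of 2 "real (m N)" "real p"] ge2[of N] by simp
    have "real (gen_pow m (Suc N)) = real (m N * p) * (real (m s) * real ?M)"
      by (simp add: p)
    also have "\<dots> \<le> real (m N * p) * (real B * real ?M)"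
      using B[of s] by (intro mult_left_mono mult_right_mono) auto
    finally have "real (gen_pow m (Suc N)) / (2 * real B * real ?M) \<le> real (m N * p) / 2"
      using Mpos \<open>B > 0\<close> by (simp add: field_simps del: gen_pow.simps)
    with \<open>real (m N * p) \<ge> 2 * real p\<close> show ?thesis by simp
  qed
  have "real (gen_pow m (Suc N)) * real ?M / (8 * real B)
      = real (gen_pow m (Suc N)) / (2 * real B * real ?M) * (real ?M * real ?M / 4)"
    using M2 by (simp add: field_simps del: gen_pow.simps)
  also have "\<dots> \<le> (real (m N * p) - real p) * (\<Sum>b<?L. g b)"
  proof (rule mult_mono[OF count sum_g])
    have "0 \<le> real (gen_pow m (Suc N)) / (2 * real B * real ?M)" by simp
    with count show "0 \<le> real (m N * p) - real p" by linarith
  qed simp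
  also have "\<dots> = (\<Sum>k<gen_pow m (Suc N). g (k mod ?L)) - (\<Sum>k<gen_pow m N. g (k mod ?L))"
    unfolding p p' sum_mod_multiple by (simp add: left_diff_distrib)
  also have "\<dots> = (\<Sum>k=gen_pow m N..<gen_pow m (Suc N). g (k mod ?L))"
    unfolding lessThan_atLeast0
    by (rule sum_diff_nat_ivl) (use gen_pow_mono[of N "Suc N"] in auto)
  finally show ?thesis by (simp only: g)
qed

lemma L1_norm_nonneg: "L1_norm m f \<ge> 0"
  unfolding L1_norm_def by (rule integral_nonneg_AE) simp

lemma integrable_partial_sum: "integrable (vilenkin m) (partial_sum m f k)"
proof -
  have "integrable (vilenkin m) (psi m i)" for i
    by (rule integrable_const_bound[of _ 1]) auto
  then show ?thesis
    unfolding partial_sum_def[abs_def]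
    by (intro Bochner_Integration.integrable_sum integrable_mult_right)
qed

context
  fixes c :: "nat \<Rightarrow> real"
  assumes c_nonneg: "\<And>n. c n \<ge> 0" and c_summable: "summable c"
begin

text \<open>
  The difference of the two \<open>near_origin\<close> terms is the indicator function of the \<open>s\<close>-th shell. The sum over
  \<open>s\<close> thus selects the shell that contains \<open>x\<close>, and it is \<open>0\<close> if \<open>x\<close> lies in \<open>I N\<close>.
\<close>

lemma shell_value_le_partial_sum:
  assumes x: "x \<in> space (vilenkin m)"
    and k: "gen_pow m N \<le> k" "k \<le> gen_pow m (Suc N)"
  shows "c N * (\<Sum>s<N. shell_value s k * (near_origin s x - near_origin (Suc s) x))
    \<le> cmod (partial_sum m (block_series c) k x) + (\<Sum>n<N. c n * cmod (block n x))"
proof (cases "\<forall>j<N. x j = 0")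
  case True
  then have "(\<Sum>s<N. shell_value s k * (near_origin s x - near_origin (Suc s) x)) = 0"
    by (intro sum.neutral) (auto simp: near_origin_def)
  then show ?thesis
    by (simp only:) (simp add: sum_nonneg c_nonneg)
next
  case False
  define s where "s = (LEAST j. x j \<noteq> 0)"
  from False obtain j0 where j0: "j0 < N" "x j0 \<noteq> 0" by auto
  have s: "x s \<noteq> 0" unfolding s_def by (rule LeastI[of _ j0]) (rule j0)
  have below: "x j = 0" if "j < s" for j using that not_less_Least unfolding s_def by blast
  have "s < N" using j0 Least_le[of "\<lambda>j. x j \<noteq> 0" j0] by (simp add: s_def)
  have near: "near_origin t x = of_bool (t \<le> s)" for t
    using s below by (auto simp: near_origin_def not_le)
  have "(\<Sum>t<N. shell_value t k * (near_origin t x - near_origin (Suc t) x))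
      = (\<Sum>t<N. if t = s then shell_value s k else 0)"
    by (intro sum.cong) (auto simp: near)
  also have "\<dots> = shell_value s k" using \<open>s < N\<close> by simp
  also have "\<dots> \<le> cmod (dirichlet k x)"
    by (rule shell_value_le_norm_dirichlet[OF x below s])
  finally have "c N * (\<Sum>t<N. shell_value t k * (near_origin t x - near_origin (Suc t) x))
      \<le> cmod (of_real (c N) * dirichlet k x)"
    by (simp add: norm_mult c_nonneg mult_left_mono)
  also have "of_real (c N) * dirichlet k x
      = partial_sum m (block_series c) k x - (\<Sum>n<N. of_real (c n) * block n x)"
    using dirichlet_gen_pow_eq_0[OF x \<open>s < N\<close> s]
      partial_sum_block_series_within[OF c_nonneg c_summable k]
      partial_sum_block_series_gen_pow[OF c_nonneg c_summable, of N]
    by simp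
  also have "cmod \<dots> \<le> cmod (partial_sum m (block_series c) k x)
      + cmod (\<Sum>n<N. of_real (c n) * block n x)"
    by (rule norm_triangle_ineq4)
  also have "cmod (\<Sum>n<N. of_real (c n) * block n x) \<le> (\<Sum>n<N. c n * cmod (block n x))"
    by (rule sum_norm_le) (simp add: norm_mult c_nonneg)
  finally show ?thesis by simp
qed

text \<open>
  The integral of the preceding pointwise bound; \<open>2 * M s\<close> enters because the shell \<open>I s - I (s + 1)\<close> has at least half
  of the measure of \<open>I s\<close>, as \<open>m s \<ge> 2\<close>.
\<close>

lemma L1_norm_partial_sum_ge:
  assumes k: "gen_pow m N \<le> k" "k \<le> gen_pow m (Suc N)"
  shows "L1_norm m (partial_sum m (block_series c) k)
    \<ge> c N * (\<Sum>s<N. shell_value s k / (2 * real (gen_pow m s))) - 2 * suminf c"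
proof -
  have shell_measure: "1 / (2 * real (gen_pow m s)) \<le> 1 / real (gen_pow m s) - 1 / real (gen_pow m (Suc s))" for s
  proof -
    have "2 * real (gen_pow m s) \<le> real (gen_pow m (Suc s))"
      using mult_right_mono[of 2 "real (m s)" "real (gen_pow m s)"] ge2[of s] by simp
    then have "1 / real (gen_pow m (Suc s)) \<le> 1 / (2 * real (gen_pow m s))"
      using gen_pow_pos[of s] by (intro divide_left_mono) (auto simp del: gen_pow.simps simp: gen_pow_pos)
    then show ?thesis by (simp add: field_simps del: gen_pow.simps)
  qed
  have "c N * (\<Sum>s<N. shell_value s k / (2 * real (gen_pow m s)))
      \<le> c N * (\<Sum>s<N. shell_value s k * (1 / real (gen_pow m s) - 1 / real (gen_pow m (Suc s))))"
  proof (intro mult_left_mono sum_mono)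
    fix s
    show "shell_value s k / (2 * real (gen_pow m s))
        \<le> shell_value s k * (1 / real (gen_pow m s) - 1 / real (gen_pow m (Suc s)))"
      using mult_left_mono[OF shell_measure, of "shell_value s k" s]
      by (simp add: shell_value_def del: gen_pow.simps)
  qed (rule c_nonneg)
  also have "\<dots> = (\<integral>x. c N * (\<Sum>s<N. shell_value s k * (near_origin s x - near_origin (Suc s) x)) \<partial>vilenkin m)"
    by (simp add: integral_near_origin integrable_near_origin del: gen_pow.simps)
  also have "\<dots> \<le> (\<integral>x. cmod (partial_sum m (block_series c) k x)
      + (\<Sum>n<N. c n * cmod (block n x)) \<partial>vilenkin m)"
    by (intro integral_mono shell_value_le_partial_sum k integrable_mult_right
        Bochner_Integration.integrable_sum Bochner_Integration.integrable_diff
        Bochner_Integration.integrable_add integrable_near_origin integrable_norm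
        integrable_partial_sum integrable_block)
  also have "\<dots> = L1_norm m (partial_sum m (block_series c) k)
      + (\<Sum>n<N. c n * (\<integral>x. cmod (block n x) \<partial>vilenkin m))"
    by (simp add: L1_norm_def integrable_partial_sum integrable_block)
  also have "(\<Sum>n<N. c n * (\<integral>x. cmod (block n x) \<partial>vilenkin m)) \<le> (\<Sum>n<N. c n * 2)"
    by (intro sum_mono mult_left_mono L1_norm_block_le c_nonneg)
  also have "\<dots> = 2 * (\<Sum>n<N. c n)" by (simp add: sum_distrib_left mult.commute)
  also have "(\<Sum>n<N. c n) \<le> suminf c"
    by (rule sum_le_suminf[OF c_summable]) (auto simp: c_nonneg)
  finally show ?thesis by simp
qed

text \<open>
  Only the indices \<open>k\<close> from \<open>M N\<close> on are used; they form at least half of the range. Exchanging the sums over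
  \<open>k\<close> and over the shells gives the same contribution \<open>n / (16 * B)\<close> for each shell with \<open>1 \<le> s < N\<close>.
\<close>

lemma average_L1_norm_ge:
  fixes N :: nat
  assumes B: "\<And>k. m k \<le> B"
  defines "n \<equiv> gen_pow m (Suc N)"
  shows "1 / real n * (\<Sum>k=1..n. L1_norm m (partial_sum m (block_series c) k))
    \<ge> c N * (real N - 1) / (16 * real B) - 2 * suminf c"
proof -
  let ?L = "\<lambda>k. L1_norm m (partial_sum m (block_series c) k)"
  let ?K = "{gen_pow m N..<n}"
  have n_pos: "real n > 0" unfolding n_def using gen_pow_pos[of "Suc N"] by (simp del: gen_pow.simps)
  have "suminf c \<ge> 0" by (rule suminf_nonneg[OF c_summable c_nonneg])
  have per_shell: "of_bool (1 \<le> s) * (real n / (16 * real B))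
      \<le> (\<Sum>k\<in>?K. shell_value s k) / (2 * real (gen_pow m s))" if "s < N" for s
  proof (cases "1 \<le> s")
    case True
    have "real n / (16 * real B) = real n * real (gen_pow m s) / (8 * real B) / (2 * real (gen_pow m s))"
      using gen_pow_pos[of s] by (simp add: field_simps)
    also have "\<dots> \<le> (\<Sum>k\<in>?K. shell_value s k) / (2 * real (gen_pow m s))"
      unfolding n_def by (intro divide_right_mono sum_shell_value True that B) simp
    finally show ?thesis using True by simp
  next
    case False
    then show ?thesis by (simp add: shell_value_def sum_nonneg del: gen_pow.simps)
  qed
  have "real N - 1 \<le> (\<Sum>s<N. of_bool (1 \<le> s))"
  proof (induction N)
    case (Suc N)
    then show ?case by (cases N) auto
  qed simp
  then have "(real N - 1) * (real n / (16 * real B))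
      \<le> (\<Sum>s<N. of_bool (1 \<le> s)) * (real n / (16 * real B))"
    by (rule mult_right_mono) simp
  also have "\<dots> \<le> (\<Sum>s<N. (\<Sum>k\<in>?K. shell_value s k) / (2 * real (gen_pow m s)))"
    unfolding sum_distrib_right by (rule sum_mono) (use per_shell in auto)
  also have "\<dots> = (\<Sum>k\<in>?K. \<Sum>s<N. shell_value s k / (2 * real (gen_pow m s)))"
    unfolding sum_divide_distrib by (rule sum.swap)
  finally have "c N * ((real N - 1) * (real n / (16 * real B)))
      \<le> c N * (\<Sum>k\<in>?K. \<Sum>s<N. shell_value s k / (2 * real (gen_pow m s)))"
    by (rule mult_left_mono[OF _ c_nonneg])
  also have "\<dots> \<le> (\<Sum>k\<in>?K. ?L k + 2 * suminf c)"
    unfolding sum_distrib_left[of "c N" _ ?K]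
  proof (rule sum_mono)
    fix k assume "k \<in> ?K"
    then show "c N * (\<Sum>s<N. shell_value s k / (2 * real (gen_pow m s))) \<le> ?L k + 2 * suminf c"
      using L1_norm_partial_sum_ge[of N k] by (simp add: n_def del: gen_pow.simps)
  qed
  also have "\<dots> = (\<Sum>k\<in>?K. ?L k) + real (card ?K) * (2 * suminf c)"
    by (simp add: sum.distrib)
  also have "\<dots> \<le> (\<Sum>k=1..n. ?L k) + real n * (2 * suminf c)"
  proof (intro add_mono mult_right_mono)
    have "?K \<subseteq> {1..n}" using gen_pow_pos[of N] by auto
    then show "(\<Sum>k\<in>?K. ?L k) \<le> (\<Sum>k=1..n. ?L k)"
      by (intro sum_mono2) (auto simp: L1_norm_nonneg)
  qed (use \<open>suminf c \<ge> 0\<close> in auto)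
  finally have "c N * (real N - 1) / (16 * real B) * real n - 2 * suminf c * real n
      \<le> (\<Sum>k=1..n. ?L k)"
    by (simp add: algebra_simps)
  then show ?thesis using n_pos by (simp add: field_simps)
qed

end

end

theorem theorem1:
  fixes m :: "nat \<Rightarrow> nat"
  assumes "\<And>k. m k \<ge> 2"
    and "bdd_above (range m)"
  shows "\<exists>f\<in>H1 m.
    (SUP n\<in>{1..}. ereal (1 / real n * (\<Sum>k=1..n. L1_norm m (partial_sum m f k)))) = \<infinity>"
proof -
  interpret vilenkin_group m using assms(1) by unfold_locales
  obtain B where B: "\<And>k. m k \<le> B" using assms(2) by (auto simp: bdd_above_def)
  have "B > 0" using assms(1)[of 0] B[of 0] by linarith
  obtain c :: "nat \<Rightarrow> real" where c: "\<And>n. c n \<ge> 0" "summable c"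
    and c_large: "\<And>K. \<exists>N. c N * (real N - 1) \<ge> K"
    using exists_summable_weight by blast
  show ?thesis
  proof (intro bexI[of _ "block_series c"] SUP_PInfty)
    fix K :: nat
    obtain N where N: "c N * (real N - 1) \<ge> (real K + 2 * suminf c) * (16 * real B)"
      using c_large by blast
    let ?n = "gen_pow m (Suc N)"
    have "real K \<le> c N * (real N - 1) / (16 * real B) - 2 * suminf c"
      using N \<open>B > 0\<close> by (simp add: field_simps)
    also have "\<dots> \<le> 1 / real ?n * (\<Sum>k=1..?n. L1_norm m (partial_sum m (block_series c) k))"
      by (rule average_L1_norm_ge[OF c B])
    finally show "\<exists>n\<in>{1..}. ereal (real K)
        \<le> ereal (1 / real n * (\<Sum>k=1..n. L1_norm m (partial_sum m (block_series c) k)))"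
      using gen_pow_pos[of "Suc N"] by (intro bexI[of _ ?n]) (auto simp del: gen_pow.simps)
  qed (rule block_series_in_H1[OF c])
qed

end
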